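(* Let $A_1,A_2$ be real $2\times2$ matrices with $A_i=P_iJ_iP_i^{-1}$, $J_i=\begin{pmatrix}-\alpha_i&\beta_i\\-\beta_i&-\alpha_i\end{pmatrix}$, $\alpha_i>0$, $\beta_i\neq0$, $P_i$ real invertible ($i=1,2$), chosen so that $M=P_2^{-1}P_1=\begin{pmatrix}a&b\\c&d\end{pmatrix}$ satisfies $\det M=\pm1$. Let $$\tau_{1,2}=\frac{1}{\alpha_1+\alpha_2}\cosh^{-1}\left(\frac{a^2+b^2+c^2+d^2}{2}\right).$$ Then the switched system $\dot x(t)=A_{\sigma(t)}x(t)$ is stable for all signals $\sigma\in S_{\tau_{1,2}}$ and asymptotically stable for all signals $\sigma\in S'_{\tau_{1,2}}$.
   Context: $\cosh^{-1}:[1,\infty)\to[0,\infty)$. A signal is a right-continuous piecewise constant $\sigma:[0,\infty)\to\{1,2\}$ with $\sigma(0)=1$ and infinitely many discontinuities $0=d_0<d_1<d_2<\cdots$, $d_k\to\infty$. For $j\ge1$, $t_j=d_{2j-1}-d_{2j-2}>0$ and $s_j=d_{2j}-d_{2j-1}>0$ are the successive times spent in subsystems $A_1$ and $A_2$. For fixed $\sigma$ the system $\dot x(t)=A_{\sigma(t)}x(t)$ on $\mathbb R^2$ is stable if for every $\epsilon>0$ there is $\delta>0$ such that $\|x(0)\|<\delta$ implies $\|x(t)\|<\epsilon$ for all $t>0$; it is asymptotically stable if it is stable and $\|x(t)\|\to0$ as $t\to\infty$ for every $x(0)$. For $\tau\ge 0$: $S_\tau$ is the set of signals with $t_j\ge\tau$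 and $s_j\ge\tau$ for all $j\in\mathbb N$; $S'_\tau$ is the set of $\sigma\in S_\tau$ for which there is an infinite subset $\Gamma\subset\mathbb N$ such that $(\tau,\tau)$ is not a limit (cluster) point of the sequence $(t_\gamma,s_\gamma)_{\gamma\in\Gamma}$. *)

theory Defs
  imports "HOL-Analysis.Analysis"
begin

text \<open>
  Signals are total functions on the reals of which only the restriction to [0, \<infinity>) matters:
  continuity is only ever evaluated at t > 0, or from the right at t \<ge> 0. Since the topology
  of nat is discrete, a discontinuity of a signal is exactly a switch.
\<close>

definition switching_times :: "(real \<Rightarrow> nat) \<Rightarrow> (nat \<Rightarrow> real) \<Rightarrow> bool" where
  "switching_times \<sigma> d \<longleftrightarrow>
     d 0 = 0 \<and> strict_mono d \<and> filterlim d at_top sequentially \<and>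
     {t. 0 < t \<and> \<not> isCont \<sigma> t} = d ` {1..} \<and>
     (\<forall>k. \<sigma> constant_on {d k..<d (Suc k)})"

definition signal :: "(real \<Rightarrow> nat) \<Rightarrow> bool" where
  "signal \<sigma> \<longleftrightarrow>
     (\<forall>t\<ge>0. \<sigma> t \<in> {1, 2}) \<and> \<sigma> 0 = 1 \<and> (\<forall>t\<ge>0. continuous (at_right t) \<sigma>) \<and>
     (\<exists>d. switching_times \<sigma> d)"

definition switching_time :: "(real \<Rightarrow> nat) \<Rightarrow> nat \<Rightarrow> real" where
  "switching_time \<sigma> = (THE d. switching_times \<sigma> d)"

lemma switching_times_unique:
  assumes "switching_times \<sigma> d" "switching_times \<sigma> d'"
  shows "d = d'"
proof -
  have range: "range e = insert 0 {t. 0 < t \<and> \<not> isCont \<sigma> t}" if "switching_times \<sigma> e" for e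
  proof -
    have "(UNIV :: nat set) = insert 0 {1..}" by auto
    then have "range e = insert (e 0) (e ` {1..})" by (metis image_insert)
    with that show ?thesis by (simp add: switching_times_def)
  qed
  have mono: "strict_mono d" "strict_mono d'"
    using assms by (auto simp: switching_times_def)
  have eq: "range d = range d'" using range assms by metis
  have le: "f n \<le> e n"
    if e: "strict_mono e" and f: "strict_mono f" and ef: "range e = range f"
      and IH: "\<And>m. m < n \<Longrightarrow> e m = f m"
    for e f :: "nat \<Rightarrow> real" and n
  proof -
    obtain m where m: "e n = f m" using ef by (metis rangeE rangeI)
    have "\<not> m < n"
    proof
      assume "m < n"
      then have "e n = e m" using IH m by simp
      with \<open>m < n\<close> e show False by (simp add: strict_mono_eq)
    qed
    then show ?thesis using f m by (simp add: strict_mono_less_eq)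
  qed
  have "d n = d' n" for n
  proof (induction n rule: less_induct)
    case (less n)
    then show ?case using le[of d d' n] le[of d' d n] mono eq by force
  qed
  then show ?thesis by blast
qed

lemma switching_times_switching_time:
  assumes "signal \<sigma>"
  shows "switching_times \<sigma> (switching_time \<sigma>)"
proof -
  from assms obtain d where "switching_times \<sigma> d" by (auto simp: signal_def)
  then show ?thesis
    unfolding switching_time_def by (metis switching_times_unique theI)
qed

text \<open>The times spent in the two subsystems are indexed by j \<ge> 1; index 0 carries no meaning.\<close>

definition dwell1 :: "(real \<Rightarrow> nat) \<Rightarrow> nat \<Rightarrow> real" where
  "dwell1 \<sigma> j = switching_time \<sigma> (2 * j - 1) - switching_time \<sigma> (2 * j - 2)"

definition dwell2 :: "(real \<Rightarrow> nat) \<Rightarrow> nat \<Rightarrow> real" where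
  "dwell2 \<sigma> j = switching_time \<sigma> (2 * j) - switching_time \<sigma> (2 * j - 1)"

definition signals_dwell :: "real \<Rightarrow> (real \<Rightarrow> nat) set" where
  "signals_dwell \<tau> = {\<sigma>. signal \<sigma> \<and> (\<forall>j\<ge>1. \<tau> \<le> dwell1 \<sigma> j \<and> \<tau> \<le> dwell2 \<sigma> j)}"

text \<open>Cluster points of a sequence: repeated values count, unlike for limit points of its range.\<close>

definition cluster_point_on :: "nat set \<Rightarrow> (nat \<Rightarrow> 'a::topological_space) \<Rightarrow> 'a \<Rightarrow> bool" where
  "cluster_point_on \<Gamma> u p \<longleftrightarrow> (\<forall>U. open U \<longrightarrow> p \<in> U \<longrightarrow> infinite {\<gamma> \<in> \<Gamma>. u \<gamma> \<in> U})"

definition signals_dwell' :: "real \<Rightarrow> (real \<Rightarrow> nat) set" where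
  "signals_dwell' \<tau> = {\<sigma> \<in> signals_dwell \<tau>.
     \<exists>\<Gamma>\<subseteq>{1..}. infinite \<Gamma> \<and> \<not> cluster_point_on \<Gamma> (\<lambda>\<gamma>. (dwell1 \<sigma> \<gamma>, dwell2 \<sigma> \<gamma>)) (\<tau>, \<tau>)}"

text \<open>
  A solution is continuous everywhere (in particular across switches) and satisfies the
  differential equation at all times other than 0 and the switching times.
\<close>

definition switched_solution ::
    "real^2^2 \<Rightarrow> real^2^2 \<Rightarrow> (real \<Rightarrow> nat) \<Rightarrow> (real \<Rightarrow> real^2) \<Rightarrow> bool" where
  "switched_solution A1 A2 \<sigma> x \<longleftrightarrow>
     continuous_on {0..} x \<and>
     (\<forall>t>0. isCont \<sigma> t \<longrightarrow>
        (x has_vector_derivative (if \<sigma> t = 1 then A1 else A2) *v x t) (at t))"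

definition switched_stable :: "real^2^2 \<Rightarrow> real^2^2 \<Rightarrow> (real \<Rightarrow> nat) \<Rightarrow> bool" where
  "switched_stable A1 A2 \<sigma> \<longleftrightarrow>
     (\<forall>\<epsilon>>0. \<exists>\<delta>>0. \<forall>x. switched_solution A1 A2 \<sigma> x \<longrightarrow> norm (x 0) < \<delta> \<longrightarrow>
        (\<forall>t>0. norm (x t) < \<epsilon>))"

definition switched_asymptotically_stable ::
    "real^2^2 \<Rightarrow> real^2^2 \<Rightarrow> (real \<Rightarrow> nat) \<Rightarrow> bool" where
  "switched_asymptotically_stable A1 A2 \<sigma> \<longleftrightarrow>
     switched_stable A1 A2 \<sigma> \<and>
     (\<forall>x. switched_solution A1 A2 \<sigma> x \<longrightarrow> ((\<lambda>t. norm (x t)) \<longlongrightarrow> 0) at_top)"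

definition focus_matrix :: "real \<Rightarrow> real \<Rightarrow> real^2^2" where
  "focus_matrix \<alpha> \<beta> = vector [vector [- \<alpha>, \<beta>], vector [- \<beta>, - \<alpha>]]"

end

theory Submission
  imports Defs
begin

text \<open>
  In the coordinates $P_i^{-1} x$ the flow of $A_i$ is a rotation times $e^{-\alpha_i t}$, so
  $V_i = |P_i^{-1} x|$ decays exactly at rate $\alpha_i$ while $A_i$ is active. As
  $|\det M| = 1$, the singular values of $M$ are $\sqrt K$ and $1/\sqrt K$, where
  $K + 1/K = a^2 + b^2 + c^2 + d^2$, that is $K = e^{(\alpha_1+\alpha_2)\tau_{1,2}}$; hence
  each switch costs a factor of at most $\sqrt K$. Over a full period $V_1$ is therefore multiplied
  by at most $e^{-\alpha_1(t_j-\tau_{1,2})-\alpha_2(s_j-\tau_{1,2})} \le 1$, and by a constant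
  less than $1$ infinitely often if $(\tau_{1,2},\tau_{1,2})$ is not a cluster point along
  $\Gamma$.
\<close>

section \<open>Norm bounds for a real 2x2 matrix of determinant 1 or -1\<close>

text \<open>The symmetric matrix with rows (p, q) and (q, r) is singular with nonnegative trace, so
  its eigenvalues are 0 and p + r. Multiplying the form by p completes the square; if p = 0, then q
  = 0 and only the term in y remains.\<close>

lemma quadratic_form_nonneg:
  fixes p q r x y :: real
  assumes "0 \<le> p + r" "p * r = q\<^sup>2"
  shows "0 \<le> p * x\<^sup>2 + 2 * q * x * y + r * y\<^sup>2"
proof -
  have "0 \<le> p * r" using assms(2) by simp
  then have nonneg: "0 \<le> p" "0 \<le> r"
    using assms(1) by (auto simp: zero_le_mult_iff)
  have "p * (p * x\<^sup>2 + 2 * q * x * y + r * y\<^sup>2) = (p * x + q * y)\<^sup>2"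
    using assms(2) by algebra
  then have "0 \<le> p * x\<^sup>2 + 2 * q * x * y + r * y\<^sup>2" if "p \<noteq> 0"
    using that nonneg by (metis less_eq_real_def zero_le_power2 zero_le_mult_iff not_less)
  moreover have ?thesis if "p = 0"
    using that assms nonneg by simp
  ultimately show ?thesis by blast
qed

lemma norm_sq_real_2: "(norm (v :: real^2))\<^sup>2 = (v $ 1)\<^sup>2 + (v $ 2)\<^sup>2"
  by (simp only: power2_norm_eq_inner) (simp add: inner_vec_def sum_2 power2_eq_square)

text \<open>The Gram matrix of \<open>M\<close> has determinant 1 and trace K + 1/K, hence
  eigenvalues K and 1/K. Subtracting it from K times the identity, or 1/K times the identity from
  it, leaves a singular matrix with nonnegative trace.\<close>

lemma unimodular_norm_bounds:
  fixes a b c d K :: real and v :: "real^2"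
  assumes M: "M = vector [vector [a, b], vector [c, d]]"
    and det: "det M = 1 \<or> det M = - 1"
    and K: "1 \<le> K" "K + 1 / K = a\<^sup>2 + b\<^sup>2 + c\<^sup>2 + d\<^sup>2"
  shows "norm (M *v v) \<le> sqrt K * norm v" "norm v \<le> sqrt K * norm (M *v v)"
proof -
  define L x y where "L = 1 / K" and "x = v $ 1" and "y = v $ 2"
  \<comment> \<open>These are the entries of the transpose of \<open>M\<close> times
    \<open>M\<close>.\<close>
  define p q r where "p = a\<^sup>2 + c\<^sup>2" and "q = a * b + c * d" and "r = b\<^sup>2 + d\<^sup>2"
  have KL: "K * L = 1" "L \<le> K"
    using K by (auto simp: L_def intro: order_trans[of _ 1])
  have trace: "p + r = K + L"
    using K(2) by (simp add: p_def r_def L_def)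
  have Mv: "(norm (M *v v))\<^sup>2 = p * x\<^sup>2 + 2 * q * x * y + r * y\<^sup>2"
    unfolding norm_sq_real_2
    by (simp add: M matrix_vector_mult_def sum_2 x_def y_def p_def q_def r_def
        power2_eq_square algebra_simps)
  have v: "(norm v)\<^sup>2 = x\<^sup>2 + y\<^sup>2"
    by (simp add: norm_sq_real_2 x_def y_def)
  \<comment> \<open>Squaring treats both signs of the determinant at once.\<close>
  have "(a * d - b * c)\<^sup>2 = 1"
    using det by (auto simp: M det_2)
  then have "p * r - q\<^sup>2 = 1"
    unfolding p_def q_def r_def by algebra
  \<comment> \<open>K and L are the roots of the characteristic polynomial of the Gram matrix, so
    both shifted matrices are singular.\<close>
  then have det': "(K - p) * (K - r) = (- q)\<^sup>2" "(p - L) * (r - L) = q\<^sup>2"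
    using KL(1) trace by algebra+
  have "0 \<le> (K - p) * x\<^sup>2 + 2 * (- q) * x * y + (K - r) * y\<^sup>2"
    using KL trace det' by (intro quadratic_form_nonneg) auto
  then have "(norm (M *v v))\<^sup>2 \<le> K * (norm v)\<^sup>2"
    unfolding Mv v by (simp add: power2_eq_square algebra_simps)
  then have "(norm (M *v v))\<^sup>2 \<le> (sqrt K * norm v)\<^sup>2"
    using K(1) by (simp add: power_mult_distrib)
  then show "norm (M *v v) \<le> sqrt K * norm v"
    by (rule power2_le_imp_le) (use K(1) in simp)
  have "0 \<le> (p - L) * x\<^sup>2 + 2 * q * x * y + (r - L) * y\<^sup>2"
    using KL trace det' by (intro quadratic_form_nonneg) auto
  then have "L * (norm v)\<^sup>2 \<le> (norm (M *v v))\<^sup>2"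
    unfolding Mv v by (simp add: power2_eq_square algebra_simps)
  then have "(norm v)\<^sup>2 \<le> K * (norm (M *v v))\<^sup>2"
    using K(1) by (simp add: L_def field_simps)
  then have "(norm v)\<^sup>2 \<le> (sqrt K * norm (M *v v))\<^sup>2"
    using K(1) by (simp add: power_mult_distrib)
  then show "norm v \<le> sqrt K * norm (M *v v)"
    by (rule power2_le_imp_le) (use K(1) in simp)
qed

section \<open>Exact decay along the flow of one focus\<close>

text \<open>The \<beta> part is skew-symmetric and drops out of the quadratic form.\<close>

lemma focus_matrix_inner:
  fixes v :: "real^2"
  shows "v \<bullet> (focus_matrix \<alpha> \<beta> *v v) = - \<alpha> * (v \<bullet> v)"
  by (simp add: focus_matrix_def inner_vec_def matrix_vector_mult_def sum_2 algebra_simps)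

text \<open>The squared norm has logarithmic derivative -2\<alpha>, so weighting it by the inverse
  exponential gives a constant of motion. The equation is assumed only in the open interval, since
  the endpoints may be switching times.\<close>

lemma norm_focus_flow:
  fixes y :: "real \<Rightarrow> real^2"
  assumes "s \<le> t" "continuous_on {s..t} y"
    and deriv: "\<And>u. s < u \<Longrightarrow> u < t \<Longrightarrow>
      (y has_vector_derivative focus_matrix \<alpha> \<beta> *v y u) (at u)"
  shows "norm (y t) = exp (- \<alpha> * (t - s)) * norm (y s)"
proof (cases "s = t")
  case False
  then have "s < t" using assms(1) by simp
  define g where "g u = exp (2 * \<alpha> * u) * (y u \<bullet> y u)" for u
  have "g t = g s"
  proof (rule DERIV_isconst_end[OF \<open>s < t\<close>])
    show "continuous_on {s..t} g"
      unfolding g_def by (intro continuous_intros assms)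
  next
    fix u assume u: "s < u" "u < t"
    have "((\<lambda>u. y u \<bullet> y u) has_real_derivative
        y u \<bullet> (focus_matrix \<alpha> \<beta> *v y u) + (focus_matrix \<alpha> \<beta> *v y u) \<bullet> y u) (at u)"
      using bounded_bilinear.has_vector_derivative[OF bounded_bilinear_inner
          deriv[OF u] deriv[OF u]]
      by (simp add: has_real_derivative_iff_has_vector_derivative)
    then have "((\<lambda>u. y u \<bullet> y u) has_real_derivative - 2 * \<alpha> * (y u \<bullet> y u)) (at u)"
      by (rule DERIV_cong) (simp add: inner_commute[of "_ *v _"] focus_matrix_inner)
    then show "DERIV g u :> 0"
      unfolding g_def by (auto intro!: derivative_eq_intros)
  qed
  then have "exp (2 * \<alpha> * t) * (norm (y t))\<^sup>2 = exp (2 * \<alpha> * s) * (norm (y s))\<^sup>2"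
    by (simp add: g_def power2_norm_eq_inner)
  then have "(exp (\<alpha> * t) * norm (y t))\<^sup>2 = (exp (\<alpha> * s) * norm (y s))\<^sup>2"
    by (simp add: power_mult_distrib mult.assoc flip: exp_double)
  then have "exp (\<alpha> * t) * norm (y t) = exp (\<alpha> * s) * norm (y s)"
    by (subst (asm) power2_eq_iff_nonneg) auto
  then show ?thesis
    by (simp add: exp_diff exp_minus field_simps)
qed simp

section \<open>From signals to the active subsystem\<close>

text \<open>Consecutive pieces carry different values: equal ones would make \<sigma> constant near
  the switch between them and hence continuous there. With two values and start 1, the parity of
  \<open>k\<close> decides.\<close>

lemma signal_value:
  assumes sig: "signal \<sigma>"
    and "switching_time \<sigma> k \<le> t" "t < switching_time \<sigma> (Suc k)"
  shows "\<sigma> t = (if even k then 1 else 2)"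
proof -
  define d where "d = switching_time \<sigma>"
  have d: "d 0 = 0" "strict_mono d" "{t. 0 < t \<and> \<not> isCont \<sigma> t} = d ` {1..}"
    and const: "\<And>k. \<sigma> constant_on {d k..<d (Suc k)}"
    using switching_times_switching_time[OF sig] by (auto simp: switching_times_def d_def)
  have less: "d k < d (Suc k)" for k using d(2) by (simp add: strict_mono_Suc_iff)
  have eq: "\<sigma> t = \<sigma> (d k)" if "d k \<le> t" "t < d (Suc k)" for k t
    using const[of k] less[of k] that by (fastforce simp: constant_on_def)
  have range: "\<sigma> (d k) \<in> {1, 2}" for k
  proof -
    have "0 \<le> d k" using d(1,2) by (metis le0 strict_mono_less_eq)
    then show ?thesis using sig by (auto simp: signal_def)
  qed
  have switch: "\<sigma> (d (Suc k)) \<noteq> \<sigma> (d k)" for k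
  proof
    assume same: "\<sigma> (d (Suc k)) = \<sigma> (d k)"
    have "\<sigma> t = \<sigma> (d k)" if "t \<in> {d k<..<d (Suc (Suc k))}" for t
      using that eq[of k t] eq[of "Suc k" t] same by (cases "t < d (Suc k)") auto
    then have "continuous_on {d k<..<d (Suc (Suc k))} \<sigma>"
      by (subst continuous_on_cong[OF refl, where g = "\<lambda>_. \<sigma> (d k)"]) auto
    then have "isCont \<sigma> (d (Suc k))"
      using less by (simp add: continuous_on_eq_continuous_at)
    moreover have "d (Suc k) \<in> d ` {1..}" by auto
    ultimately show False using d(3) by blast
  qed
  have "\<sigma> (d k) = (if even k then 1 else 2)"
  proof (induction k)
    case 0
    then show ?case using sig d(1) by (simp add: signal_def)
  next
    case (Suc k)
    then show ?case using switch[of k] range[of "Suc k"] by (auto split: if_splits)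
  qed
  then show ?thesis using eq assms(2,3) by (simp add: d_def)
qed

text \<open>In the coordinates \<open>Q *v x\<close> the active matrix becomes the focus matrix,
  because \<open>Q\<close> cancels \<open>P\<close> from the left. The parity condition in the
  hypothesis serves both subsystems with one proof, and continuity of \<open>x\<close> admits both
  ends of the interval.\<close>

lemma norm_switched_flow:
  fixes P Q :: "real^2^2"
  assumes sol: "switched_solution A1 A2 \<sigma> x" and sig: "signal \<sigma>"
    and Q: "Q ** P = mat 1"
    and A: "(if even k then A1 else A2) = P ** focus_matrix \<alpha> \<beta> ** Q"
    and t: "switching_time \<sigma> k \<le> t" "t \<le> switching_time \<sigma> (Suc k)"
  shows "norm (Q *v x t) =
    exp (- \<alpha> * (t - switching_time \<sigma> k)) * norm (Q *v x (switching_time \<sigma> k))"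
proof (rule norm_focus_flow[OF t(1)])
  define d where "d = switching_time \<sigma>"
  have d: "d 0 = 0" "strict_mono d" "{t. 0 < t \<and> \<not> isCont \<sigma> t} = d ` {1..}"
    using switching_times_switching_time[OF sig] by (auto simp: switching_times_def d_def)
  have dk: "0 \<le> d k" using d(1,2) by (metis le0 strict_mono_less_eq)
  have "continuous_on {d k..t} x"
    using sol dk by (auto simp: switched_solution_def elim: continuous_on_subset)
  then show "continuous_on {switching_time \<sigma> k..t} (\<lambda>u. Q *v x u)"
    unfolding d_def
    by (rule bounded_linear.continuous_on[OF matrix_vector_mul_bounded_linear])
  fix u assume "switching_time \<sigma> k < u" "u < t"
  then have u: "d k < u" "u < d (Suc k)" using t by (auto simp: d_def)
  have "u \<notin> d ` {1..}"
    using u d(2) by (auto simp: strict_mono_less)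
  then have "isCont \<sigma> u" using d(3) u dk by auto
  then have "(x has_vector_derivative (if \<sigma> u = 1 then A1 else A2) *v x u) (at u)"
    using sol u dk by (simp add: switched_solution_def)
  also have "(if \<sigma> u = 1 then A1 else A2) = P ** focus_matrix \<alpha> \<beta> ** Q"
    using signal_value[OF sig, of k u] u A by (auto simp: d_def)
  finally have "((\<lambda>u. Q *v x u) has_vector_derivative
      Q *v ((P ** focus_matrix \<alpha> \<beta> ** Q) *v x u)) (at u)"
    by (rule bounded_linear.has_vector_derivative[OF matrix_vector_mul_bounded_linear])
  then show "((\<lambda>u. Q *v x u) has_vector_derivative
      focus_matrix \<alpha> \<beta> *v (Q *v x u)) (at u)"
    using Q by (simp add: matrix_vector_mul_assoc matrix_mul_assoc)
qed

lemma matrix_inv_mult: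
  assumes "invertible (P :: real^'n^'n)"
  shows "matrix_inv P ** P = mat 1" "P ** matrix_inv P = mat 1"
proof -
  have "\<exists>Q. P ** Q = mat 1 \<and> Q ** P = mat 1"
    using assms by (simp add: invertible_def)
  then show "matrix_inv P ** P = mat 1" "P ** matrix_inv P = mat 1"
    unfolding matrix_inv_def by (metis (mono_tags, lifting) someI_ex)+
qed

section \<open>Cluster points and monotone sequences\<close>

text \<open>Some neighbourhood of the point is visited only finitely often along \<Gamma>, and it
  contains a small box. All but finitely many indices of \<Gamma> therefore leave the box in at
  least one coordinate.\<close>

lemma not_cluster_point_on_diagonal:
  fixes f g :: "nat \<Rightarrow> real"
  assumes "infinite \<Gamma>" "\<not> cluster_point_on \<Gamma> (\<lambda>n. (f n, g n)) (\<tau>, \<tau>)"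
  obtains e where "0 < e" "infinite {n \<in> \<Gamma>. e \<le> \<bar>f n - \<tau>\<bar> \<or> e \<le> \<bar>g n - \<tau>\<bar>}"
proof -
  obtain U where U: "open U" "(\<tau>, \<tau>) \<in> U" "finite {n \<in> \<Gamma>. (f n, g n) \<in> U}"
    using assms(2) by (auto simp: cluster_point_on_def)
  then obtain e where e: "0 < e" "\<And>p. dist p (\<tau>, \<tau>) < e \<Longrightarrow> p \<in> U"
    unfolding open_dist by blast
  \<comment> \<open>Half the radius in each coordinate suffices, the Euclidean distance being at
    most the sum of the coordinate distances.\<close>
  have "(f n, g n) \<in> U" if "\<bar>f n - \<tau>\<bar> < e / 2" "\<bar>g n - \<tau>\<bar> < e / 2" for n
  proof (rule e(2))
    have "dist (f n, g n) (\<tau>, \<tau>) \<le> \<bar>f n - \<tau>\<bar> + \<bar>g n - \<tau>\<bar>"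
      using sqrt_sum_squares_le_sum_abs[of "f n - \<tau>" "g n - \<tau>"]
      by (simp add: dist_Pair_Pair dist_real_def)
    then show "dist (f n, g n) (\<tau>, \<tau>) < e" using that by simp
  qed
  then have "\<Gamma> \<subseteq> {n \<in> \<Gamma>. (f n, g n) \<in> U} \<union>
      {n \<in> \<Gamma>. e / 2 \<le> \<bar>f n - \<tau>\<bar> \<or> e / 2 \<le> \<bar>g n - \<tau>\<bar>}"
    by (force simp: not_le)
  then have "infinite {n \<in> \<Gamma>. e / 2 \<le> \<bar>f n - \<tau>\<bar> \<or> e / 2 \<le> \<bar>g n - \<tau>\<bar>}"
    using assms(1) U(3) by (meson finite_Un finite_subset)
  then show thesis using e(1) that[of "e / 2"] by simp
qed

text \<open>A decreasing nonnegative sequence has a limit L. If L were positive,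
  \<open>W (Suc j) - q * W j\<close> would tend to (1 - q) L > 0, so contraction by \<open>q\<close>
  could happen only finitely often.\<close>

lemma tendsto_0_if_contracting_infinitely_often:
  fixes W :: "nat \<Rightarrow> real"
  assumes "\<And>j. 0 \<le> W j" "\<And>j. W (Suc j) \<le> W j"
    and "q < 1" "infinite {j. W (Suc j) \<le> q * W j}"
  shows "W \<longlonglongrightarrow> 0"
proof -
  have "decseq W" using assms(2) by (simp add: decseq_Suc_iff)
  then obtain L where L: "W \<longlonglongrightarrow> L" "\<And>j. L \<le> W j"
    using decseq_convergent[of W 0] assms(1) by blast
  have "0 \<le> L" using L(1) assms(1) by (simp add: LIMSEQ_le_const)
  moreover have False if "0 < L"
  proof -
    have "(\<lambda>j. W (Suc j) - q * W j) \<longlonglongrightarrow> L - q * L"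
      using L(1) by (intro tendsto_intros LIMSEQ_Suc)
    moreover have "0 < L - q * L" using that assms(3) by simp
    ultimately have "\<forall>\<^sub>F j in sequentially. 0 < W (Suc j) - q * W j"
      by (rule order_tendstoD(1))
    then have "finite {j. \<not> 0 < W (Suc j) - q * W j}"
      by (simp add: eventually_cofinite flip: cofinite_eq_sequentially)
    then show False using assms(4) by (simp add: not_less)
  qed
  ultimately show ?thesis using L(1) by fastforce
qed

section \<open>Decay of the switched system over whole periods\<close>

text \<open>\<open>Q1\<close> and \<open>Q2\<close> stand for the inverses of \<open>P1\<close> and
  \<open>P2\<close>. The matrix M enters only through \<open>compare\<close>, the cost of one change
  of coordinates, and \<tau> is tied to that cost by the exponential formula for
  \<open>K\<close>.\<close>

locale switched_foci =
  fixes A1 A2 P1 P2 Q1 Q2 :: "real^2^2" and \<alpha>1 \<alpha>2 \<beta>1 \<beta>2 K \<tau> :: real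
  assumes pos: "\<alpha>1 > 0" "\<alpha>2 > 0"
    and inverse: "Q1 ** P1 = mat 1" "P1 ** Q1 = mat 1" "Q2 ** P2 = mat 1" "P2 ** Q2 = mat 1"
    and A1: "A1 = P1 ** focus_matrix \<alpha>1 \<beta>1 ** Q1"
    and A2: "A2 = P2 ** focus_matrix \<alpha>2 \<beta>2 ** Q2"
    and K: "1 \<le> K" "K = exp ((\<alpha>1 + \<alpha>2) * \<tau>)"
    and compare: "\<And>v. norm (Q2 *v v) \<le> sqrt K * norm (Q1 *v v)"
      "\<And>v. norm (Q1 *v v) \<le> sqrt K * norm (Q2 *v v)"
begin

text \<open>Stability speaks of the Euclidean norm, decay of the norms in the adapted coordinates.
  One constant, the sum of three operator bounds, serves for every conversion between them.\<close>

lemma norm_le_norms: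
  obtains C where "0 < C" "\<And>v. norm v \<le> C * norm (Q1 *v v)" "\<And>v. norm v \<le> C * norm (Q2 *v v)"
    "\<And>v. norm (Q1 *v v) \<le> C * norm v"
proof -
  obtain C1 where C1: "0 < C1" "\<And>w. norm (P1 *v w) \<le> norm w * C1"
    using bounded_linear.pos_bounded[OF matrix_vector_mul_bounded_linear] by blast
  obtain C2 where C2: "0 < C2" "\<And>w. norm (P2 *v w) \<le> norm w * C2"
    using bounded_linear.pos_bounded[OF matrix_vector_mul_bounded_linear] by blast
  obtain C3 where C3: "0 < C3" "\<And>w. norm (Q1 *v w) \<le> norm w * C3"
    using bounded_linear.pos_bounded[OF matrix_vector_mul_bounded_linear] by blast
  show thesis
  proof (rule that[of "C1 + C2 + C3"])
    fix v :: "real^2"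
    have "v = P1 *v (Q1 *v v)" "v = P2 *v (Q2 *v v)"
      by (simp_all add: matrix_vector_mul_assoc inverse)
    then have "norm v \<le> norm (Q1 *v v) * C1" "norm v \<le> norm (Q2 *v v) * C2"
      using C1(2) C2(2) by metis+
    moreover have "norm (Q1 *v v) * C1 \<le> (C1 + C2 + C3) * norm (Q1 *v v)"
      "norm (Q2 *v v) * C2 \<le> (C1 + C2 + C3) * norm (Q2 *v v)"
      "norm v * C3 \<le> (C1 + C2 + C3) * norm v"
      using C1(1) C2(1) C3(1) by (simp_all add: algebra_simps)
    ultimately show "norm v \<le> (C1 + C2 + C3) * norm (Q1 *v v)"
      "norm v \<le> (C1 + C2 + C3) * norm (Q2 *v v)"
      "norm (Q1 *v v) \<le> (C1 + C2 + C3) * norm v"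
      using C3(2)[of v] by linarith+
  qed (use C1(1) C2(1) C3(1) in simp)
qed

text \<open>\<open>W\<close> samples the first adapted norm at even switching times, that is, at the
  start of each period, when subsystem 1 takes over.\<close>

context
  fixes \<sigma> :: "real \<Rightarrow> nat" and x :: "real \<Rightarrow> real^2" and W :: "nat \<Rightarrow> real"
  assumes dwell: "\<sigma> \<in> signals_dwell \<tau>" and sol: "switched_solution A1 A2 \<sigma> x"
  defines "W \<equiv> \<lambda>j. norm (Q1 *v x (switching_time \<sigma> (2 * j)))"
begin

lemma sig: "signal \<sigma>"
  using dwell by (simp add: signals_dwell_def)

lemma
  shows switching_time_0: "switching_time \<sigma> 0 = 0"
    and switching_time_Suc: "switching_time \<sigma> k < switching_time \<sigma> (Suc k)"
    and switching_time_at_top: "filterlim (switching_time \<sigma>) at_top sequentially"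
  using switching_times_switching_time[OF sig]
  by (auto simp: switching_times_def strict_mono_Suc_iff)

lemma norm_in_A1:
  assumes "switching_time \<sigma> (2 * j) \<le> t" "t \<le> switching_time \<sigma> (Suc (2 * j))"
  shows "norm (Q1 *v x t) = exp (- \<alpha>1 * (t - switching_time \<sigma> (2 * j))) * W j"
  unfolding W_def using norm_switched_flow[OF sol sig inverse(1) _ assms] A1 by simp

text \<open>The factors are, from right to left, the full stay in subsystem 1, one change of
  coordinates and the partial stay in subsystem 2. Periods count from 0 but dwell times from 1,
  hence \<open>Suc j\<close>.\<close>

lemma norm_in_A2:
  assumes "switching_time \<sigma> (Suc (2 * j)) \<le> t" "t \<le> switching_time \<sigma> (2 * Suc j)"
  shows "norm (Q2 *v x t) \<le> exp (- \<alpha>2 * (t - switching_time \<sigma> (Suc (2 * j)))) *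
    (sqrt K * (exp (- \<alpha>1 * dwell1 \<sigma> (Suc j)) * W j))"
proof -
  let ?s = "switching_time \<sigma> (Suc (2 * j))"
  have "norm (Q1 *v x ?s) = exp (- \<alpha>1 * dwell1 \<sigma> (Suc j)) * W j"
    using norm_in_A1[of j ?s] switching_time_Suc[of "2 * j"] by (simp add: dwell1_def)
  then have "norm (Q2 *v x ?s) \<le> sqrt K * (exp (- \<alpha>1 * dwell1 \<sigma> (Suc j)) * W j)"
    using compare(1)[of "x ?s"] by simp
  moreover have "norm (Q2 *v x t) = exp (- \<alpha>2 * (t - ?s)) * norm (Q2 *v x ?s)"
  proof (rule norm_switched_flow[OF sol sig inverse(3) _ assms(1)])
    show "(if even (Suc (2 * j)) then A1 else A2) = P2 ** focus_matrix \<alpha>2 \<beta>2 ** Q2"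
      using A2 by simp
    show "t \<le> switching_time \<sigma> (Suc (Suc (2 * j)))"
      using assms(2) by simp
  qed
  ultimately show ?thesis by simp
qed

lemma W_Suc_le:
  "W (Suc j) \<le> exp (- (\<alpha>1 * (dwell1 \<sigma> (Suc j) - \<tau>) + \<alpha>2 * (dwell2 \<sigma> (Suc j) - \<tau>))) * W j"
proof -
  let ?t = "dwell1 \<sigma> (Suc j)" and ?s = "dwell2 \<sigma> (Suc j)"
  have "norm (Q2 *v x (switching_time \<sigma> (2 * Suc j))) \<le>
      exp (- \<alpha>2 * ?s) * (sqrt K * (exp (- \<alpha>1 * ?t) * W j))"
    using norm_in_A2[of j "switching_time \<sigma> (2 * Suc j)"] switching_time_Suc[of "Suc (2 * j)"]
    by (simp add: dwell2_def)
  then have "sqrt K * norm (Q2 *v x (switching_time \<sigma> (2 * Suc j))) \<le>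
      sqrt K * (exp (- \<alpha>2 * ?s) * (sqrt K * (exp (- \<alpha>1 * ?t) * W j)))"
    using K(1) by (intro mult_left_mono) auto
  then have "W (Suc j) \<le> sqrt K * (exp (- \<alpha>2 * ?s) * (sqrt K * (exp (- \<alpha>1 * ?t) * W j)))"
    unfolding W_def using compare(2) by (rule order_trans[rotated])
  also have "\<dots> = (sqrt K * sqrt K) * exp (- \<alpha>2 * ?s) * exp (- \<alpha>1 * ?t) * W j"
    by (simp only: mult_ac)
  \<comment> \<open>The two switches of a period cost K together; as an exponential it is absorbed
    by subtracting \<tau> from each dwell time.\<close>
  also have "sqrt K * sqrt K = exp ((\<alpha>1 + \<alpha>2) * \<tau>)"
    using K by simp
  also have "exp ((\<alpha>1 + \<alpha>2) * \<tau>) * exp (- \<alpha>2 * ?s) * exp (- \<alpha>1 * ?t) =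
      exp (- (\<alpha>1 * (?t - \<tau>) + \<alpha>2 * (?s - \<tau>)))"
    by (simp add: algebra_simps flip: exp_add)
  finally show ?thesis .
qed

lemma dwell_ge: "\<tau> \<le> dwell1 \<sigma> (Suc j)" "\<tau> \<le> dwell2 \<sigma> (Suc j)"
  using dwell by (auto simp: signals_dwell_def)

lemma W_nonneg: "0 \<le> W j"
  by (simp add: W_def)

lemma W_decreasing: "W (Suc j) \<le> W j"
proof -
  have "exp (- (\<alpha>1 * (dwell1 \<sigma> (Suc j) - \<tau>) + \<alpha>2 * (dwell2 \<sigma> (Suc j) - \<tau>))) \<le> 1"
    using dwell_ge[of j] pos by (simp add: add_nonneg_nonneg del: minus_add_distrib)
  from mult_right_mono[OF this W_nonneg[of j]] show ?thesis
    using W_Suc_le[of j] by linarith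
qed

text \<open>At most one change of coordinates occurs before \<open>t\<close>, so the overshoot
  inside a period is at most \<open>sqrt K\<close>; all exponential decay is bounded by 1.\<close>

lemma norm_bound_in_period:
  assumes C: "0 < C" "\<And>v. norm v \<le> C * norm (Q1 *v v)" "\<And>v. norm v \<le> C * norm (Q2 *v v)"
    and t: "switching_time \<sigma> (2 * j) \<le> t" "t \<le> switching_time \<sigma> (2 * Suc j)"
  shows "norm (x t) \<le> C * (sqrt K * W j)"
proof (cases "t \<le> switching_time \<sigma> (Suc (2 * j))")
  case True
  have "norm (Q1 *v x t) = exp (- \<alpha>1 * (t - switching_time \<sigma> (2 * j))) * W j"
    by (rule norm_in_A1[OF t(1) True])
  also have "\<dots> \<le> 1 * W j"
    using pos t(1) W_nonneg by (intro mult_right_mono) auto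
  also have "\<dots> \<le> sqrt K * W j"
    using K(1) W_nonneg by (intro mult_right_mono) auto
  finally have "C * norm (Q1 *v x t) \<le> C * (sqrt K * W j)"
    using C(1) by simp
  then show ?thesis using C(2)[of "x t"] by linarith
next
  case False
  have "norm (Q2 *v x t) \<le> exp (- \<alpha>2 * (t - switching_time \<sigma> (Suc (2 * j)))) *
      (sqrt K * (exp (- \<alpha>1 * dwell1 \<sigma> (Suc j)) * W j))"
    using False t(2) by (intro norm_in_A2) auto
  also have "\<dots> \<le> 1 * (sqrt K * (1 * W j))"
    using pos K(1) W_nonneg False switching_time_Suc[of "2 * j"]
    by (intro mult_mono mult_left_mono mult_right_mono) (auto simp: dwell1_def)
  finally have "C * norm (Q2 *v x t) \<le> C * (sqrt K * W j)"
    using C(1) by simp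
  then show ?thesis using C(3)[of "x t"] by linarith
qed

lemma period_exists:
  assumes "0 \<le> t"
  obtains j where "switching_time \<sigma> (2 * j) \<le> t" "t \<le> switching_time \<sigma> (2 * Suc j)"
proof -
  \<comment> \<open>Minimality places the end of the preceding period before \<open>t\<close>; for
    \<open>j = 0\<close> the lower bound is \<open>0 \<le> t\<close>.\<close>
  define j where "j = (LEAST j. t \<le> switching_time \<sigma> (2 * Suc j))"
  obtain k where k: "t \<le> switching_time \<sigma> k"
    using switching_time_at_top by (auto simp: filterlim_at_top eventually_sequentially)
  have mono: "switching_time \<sigma> m \<le> switching_time \<sigma> n" if "m \<le> n" for m n
    using that switching_time_Suc by (metis lift_Suc_mono_le less_imp_le)
  have "t \<le> switching_time \<sigma> (2 * Suc k)"
    using k mono[of k "2 * Suc k"] by simp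
  then have upper: "t \<le> switching_time \<sigma> (2 * Suc j)"
    unfolding j_def by (rule LeastI)
  have "switching_time \<sigma> (2 * j) \<le> t"
  proof (cases j)
    case 0
    then show ?thesis using assms switching_time_0 by simp
  next
    case (Suc i)
    then have "\<not> t \<le> switching_time \<sigma> (2 * Suc i)"
      using not_less_Least[of i "\<lambda>j. t \<le> switching_time \<sigma> (2 * Suc j)"] by (simp add: j_def)
    then show ?thesis using Suc by simp
  qed
  with upper show thesis by (rule that[rotated])
qed

lemma W_antimono: "i \<le> j \<Longrightarrow> W j \<le> W i"
  using W_decreasing by (rule lift_Suc_antimono_le)

lemma norm_le_initial:
  assumes C: "0 < C" "\<And>v. norm v \<le> C * norm (Q1 *v v)" "\<And>v. norm v \<le> C * norm (Q2 *v v)"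
      "\<And>v. norm (Q1 *v v) \<le> C * norm v"
    and "0 \<le> t"
  shows "norm (x t) \<le> C * (sqrt K * (C * norm (x 0)))"
proof -
  obtain j where "switching_time \<sigma> (2 * j) \<le> t" "t \<le> switching_time \<sigma> (2 * Suc j)"
    using period_exists assms(5) by blast
  then have "norm (x t) \<le> C * (sqrt K * W j)"
    by (rule norm_bound_in_period[OF C(1-3)])
  moreover have "W j \<le> C * norm (x 0)"
    using W_antimono[of 0 j] C(4)[of "x 0"] by (simp add: W_def switching_time_0)
  then have "C * (sqrt K * W j) \<le> C * (sqrt K * (C * norm (x 0)))"
    using C(1) K(1) by (intro mult_left_mono) auto
  ultimately show ?thesis by linarith
qed

text \<open>The overshoot factor does not depend on the period, so convergence at the period starts
  passes to all times.\<close>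

lemma norm_tendsto_0_if_W:
  assumes "W \<longlonglongrightarrow> 0"
  shows "((\<lambda>t. norm (x t)) \<longlongrightarrow> 0) at_top"
proof -
  obtain C where C: "0 < C" "\<And>v. norm v \<le> C * norm (Q1 *v v)" "\<And>v. norm v \<le> C * norm (Q2 *v v)"
    by (rule norm_le_norms) blast
  have lim: "(\<lambda>j. C * (sqrt K * W j)) \<longlonglongrightarrow> 0"
    by (intro tendsto_mult_right_zero assms)
  show ?thesis
  proof (rule tendstoI)
    fix e :: real assume "0 < e"
    then obtain n where n: "C * (sqrt K * W n) < e"
      using order_tendstoD(2)[OF lim] by (auto simp: eventually_sequentially)
    have "norm (x t) < e" if t: "max 0 (switching_time \<sigma> (2 * n)) < t" for t
    proof -
      obtain j where j: "switching_time \<sigma> (2 * j) \<le> t" "t \<le> switching_time \<sigma> (2 * Suc j)"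
        using period_exists[of t] t by auto
      \<comment> \<open>A time after the start of period \<open>n\<close> can only lie in a period
        \<open>j\<close> with \<open>n \<le> j\<close>.\<close>
      have "switching_time \<sigma> (2 * n) < switching_time \<sigma> (2 * Suc j)" using t j by simp
      moreover have "strict_mono (switching_time \<sigma>)"
        using switching_time_Suc by (simp add: strict_mono_Suc_iff)
      ultimately have "n \<le> j" by (simp add: strict_mono_less)
      then have "C * (sqrt K * W j) \<le> C * (sqrt K * W n)"
        using C(1) K(1) W_antimono by (intro mult_left_mono) auto
      then show ?thesis using norm_bound_in_period[OF C j] n by linarith
    qed
    then show "\<forall>\<^sub>F t in at_top. dist (norm (x t)) 0 < e"
      using eventually_gt_at_top[of "max 0 (switching_time \<sigma> (2 * n))"]
      by (auto elim: eventually_mono)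
  qed
qed

lemma W_tendsto_0:
  assumes "\<sigma> \<in> signals_dwell' \<tau>"
  shows "W \<longlonglongrightarrow> 0"
proof -
  obtain \<Gamma> where \<Gamma>: "\<Gamma> \<subseteq> {1..}" "infinite \<Gamma>"
      "\<not> cluster_point_on \<Gamma> (\<lambda>\<gamma>. (dwell1 \<sigma> \<gamma>, dwell2 \<sigma> \<gamma>)) (\<tau>, \<tau>)"
    using assms by (auto simp: signals_dwell'_def)
  obtain e where e: "0 < e"
      "infinite {n \<in> \<Gamma>. e \<le> \<bar>dwell1 \<sigma> n - \<tau>\<bar> \<or> e \<le> \<bar>dwell2 \<sigma> n - \<tau>\<bar>}" (is "infinite ?S")
    using not_cluster_point_on_diagonal[OF \<Gamma>(2,3)] by blast
  \<comment> \<open>When one dwell time exceeds \<tau> by at least \<open>e\<close>, the exponent in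
    \<open>W_Suc_le\<close> is at most -\<eta>, as the other excess is nonnegative.\<close>
  define \<eta> where "\<eta> = min \<alpha>1 \<alpha>2 * e"
  have "0 < \<eta>" using pos e(1) by (simp add: \<eta>_def)
  have contract: "W (Suc j) \<le> exp (- \<eta>) * W j" if "Suc j \<in> ?S" for j
  proof -
    let ?t = "dwell1 \<sigma> (Suc j) - \<tau>" and ?s = "dwell2 \<sigma> (Suc j) - \<tau>"
    have nonneg: "0 \<le> ?t" "0 \<le> ?s" using dwell_ge[of j] by auto
    then have "e \<le> ?t + ?s" using that by auto
    then have "\<eta> \<le> min \<alpha>1 \<alpha>2 * (?t + ?s)"
      using pos by (simp add: \<eta>_def mult_left_mono)
    also have "\<dots> \<le> \<alpha>1 * ?t + \<alpha>2 * ?s"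
      unfolding distrib_left using nonneg by (intro add_mono mult_right_mono) auto
    finally have "exp (- (\<alpha>1 * ?t + \<alpha>2 * ?s)) * W j \<le> exp (- \<eta>) * W j"
      by (intro mult_right_mono W_nonneg) simp
    then show ?thesis using W_Suc_le[of j] by linarith
  qed
  \<comment> \<open>Since \<Gamma> avoids 0, each of its indices is the successor of a period
    number.\<close>
  have "?S \<subseteq> Suc ` {j. W (Suc j) \<le> exp (- \<eta>) * W j}"
  proof
    fix n assume n: "n \<in> ?S"
    then obtain j where "n = Suc j" using \<Gamma>(1) by (cases n) auto
    then show "n \<in> Suc ` {j. W (Suc j) \<le> exp (- \<eta>) * W j}" using contract n by auto
  qed
  then have "infinite {j. W (Suc j) \<le> exp (- \<eta>) * W j}"
    using e(2) finite_subset[OF _ finite_imageI] by blast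
  then show ?thesis
    using \<open>0 < \<eta>\<close> by (intro tendsto_0_if_contracting_infinitely_often[of W "exp (- \<eta>)"]
        W_nonneg W_decreasing) auto
qed

end

section \<open>Stability and asymptotic stability\<close>

text \<open>A linear bound on the norm by its initial value, with a constant \<open>D\<close> common
  to all solutions, allows \<delta> = \<epsilon> / D.\<close>

lemma stable:
  assumes "\<sigma> \<in> signals_dwell \<tau>"
  shows "switched_stable A1 A2 \<sigma>"
proof -
  obtain C where C: "0 < C" "\<And>v. norm v \<le> C * norm (Q1 *v v)" "\<And>v. norm v \<le> C * norm (Q2 *v v)"
      "\<And>v. norm (Q1 *v v) \<le> C * norm v"
    by (rule norm_le_norms) blast
  define D where "D = C * sqrt K * C"
  have "0 < D" using C(1) K(1) by (simp add: D_def)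
  have bound: "norm (x t) \<le> D * norm (x 0)"
    if "switched_solution A1 A2 \<sigma> x" "0 < t" for x t
    using norm_le_initial[OF assms that(1) C, of t] that(2) by (simp add: D_def mult_ac)
  show ?thesis
    unfolding switched_stable_def
  proof (intro allI impI)
    fix \<epsilon> :: real assume "0 < \<epsilon>"
    show "\<exists>\<delta>>0. \<forall>x. switched_solution A1 A2 \<sigma> x \<longrightarrow> norm (x 0) < \<delta> \<longrightarrow> (\<forall>t>0. norm (x t) < \<epsilon>)"
    proof (intro exI[of _ "\<epsilon> / D"] conjI allI impI)
      fix x t assume "switched_solution A1 A2 \<sigma> x" "norm (x 0) < \<epsilon> / D" "0 < (t :: real)"
      then show "norm (x t) < \<epsilon>"
        using bound[of x t] \<open>0 < D\<close> by (simp add: field_simps)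
    qed (use \<open>0 < D\<close> \<open>0 < \<epsilon>\<close> in simp)
  qed
qed

lemma asymptotically_stable:
  assumes "\<sigma> \<in> signals_dwell' \<tau>"
  shows "switched_asymptotically_stable A1 A2 \<sigma>"
proof -
  have dwell: "\<sigma> \<in> signals_dwell \<tau>" using assms by (simp add: signals_dwell'_def)
  show ?thesis
    unfolding switched_asymptotically_stable_def
    using stable[OF dwell] norm_tendsto_0_if_W[OF dwell] W_tendsto_0[OF dwell _ assms] by blast
qed

end

section \<open>Identification of K with the threshold dwell time\<close>

theorem theorem4p2:
  fixes A1 A2 P1 P2 M :: "real^2^2"
    and \<alpha>1 \<alpha>2 \<beta>1 \<beta>2 a b c d \<tau>12 :: real
  assumes "\<alpha>1 > 0" and "\<alpha>2 > 0" and "\<beta>1 \<noteq> 0" and "\<beta>2 \<noteq> 0"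
    and "invertible P1" and "invertible P2"
    and "A1 = P1 ** focus_matrix \<alpha>1 \<beta>1 ** matrix_inv P1"
    and "A2 = P2 ** focus_matrix \<alpha>2 \<beta>2 ** matrix_inv P2"
    and "M = matrix_inv P2 ** P1"
    and "M = vector [vector [a, b], vector [c, d]]"
    and "det M = 1 \<or> det M = - 1"
    and "\<tau>12 = 1 / (\<alpha>1 + \<alpha>2) * arcosh ((a\<^sup>2 + b\<^sup>2 + c\<^sup>2 + d\<^sup>2) / 2)"
  shows "(\<forall>\<sigma> \<in> signals_dwell \<tau>12. switched_stable A1 A2 \<sigma>) \<and>
         (\<forall>\<sigma> \<in> signals_dwell' \<tau>12. switched_asymptotically_stable A1 A2 \<sigma>)"
proof -
  define F where "F = a\<^sup>2 + b\<^sup>2 + c\<^sup>2 + d\<^sup>2"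
  define K where "K = exp (arcosh (F / 2))"
  \<comment> \<open>These squares expand to F - 2 det M and F + 2 det M. Hence F is at least 2,
    which puts F / 2 in the domain of \<open>arcosh\<close>.\<close>
  have "0 \<le> (a - d)\<^sup>2 + (b + c)\<^sup>2" "0 \<le> (a + d)\<^sup>2 + (b - c)\<^sup>2" by simp_all
  moreover have "a * d - b * c = 1 \<or> a * d - b * c = - 1"
    using assms(10,11) by (simp add: det_2)
  ultimately have F: "1 \<le> F / 2"
    by (auto simp: F_def power2_eq_square algebra_simps)
  have K_ge: "1 \<le> K"
    using F by (simp add: K_def arcosh_nonneg_real)
  have "(K + 1 / K) / 2 = cosh (arcosh (F / 2))"
    by (simp add: K_def cosh_def exp_minus inverse_eq_divide)
  then have K_F: "K + 1 / K = F" using F by simp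
  note inv = matrix_inv_mult[OF assms(5)] matrix_inv_mult[OF assms(6)]
  \<comment> \<open>M carries the first adapted coordinates to the second, so the two bounds for M
    become the two \<open>compare\<close> conditions.\<close>
  have M: "matrix_inv P2 *v v = M *v (matrix_inv P1 *v v)" for v
    by (simp add: assms(9) matrix_vector_mul_assoc inv flip: matrix_mul_assoc)
  note bounds = unimodular_norm_bounds[OF assms(10,11) K_ge K_F[unfolded F_def]]
  interpret switched_foci A1 A2 P1 P2 "matrix_inv P1" "matrix_inv P2" \<alpha>1 \<alpha>2 \<beta>1 \<beta>2 K \<tau>12
    by unfold_locales
      (use assms(1,2,7,8,12) inv K_ge bounds in \<open>auto simp: M K_def F_def\<close>)
  show ?thesis using stable asymptotically_stable by blast
qed

end
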